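(* In the batched dynamic network model described in the context, allowing node insertions, edge insertions, node deletions and edge deletions, the deterministic $1$-round bandwidth complexity of $\mathsf{BatchedList}(K_3)$ is $O(\log n)$, where $n$ is the current number of nodes. That is, there is a deterministic algorithm in which each node sends each neighbor $O(\log n)$ bits per round, and after the single round of communication following each batch of updates every triangle of the current graph is listed by at least one of its nodes and no set of three nodes that is not a triangle of the current graph is listed.
   Context: Batched dynamic network model: the network is a sequence of graphs $(G_0, G_1, \dots, G_r)$, $G_i=(V_i,E_i)$. All nodes of $G_0$ know its complete topology. $G_i$ is obtained from $G_{i-1}$ by a batch of updates (node insertions together with their incident edges, node deletions together with their incident edges, edge insertions, edge deletions) such that every node of $V_i$ is incident to at most $O(1)$ updates; in particular a newly inserted node $u\in V_i\setminus V_{i-1}$ has only newly inserted incident edges, hence $O(1)$ of them. Each node has a unique ID of $O(\log n)$ bits ($n$ the current number of nodes) and knows the IDs of its current neighbors. Communication is synchronous; each round: (1) the batch of updates occurs and each node learns its new neighbor list; (2) each node sends each of its current neighbors a message of at most $B$ bits (the bandwidth); (3) nodes receive messages and output their lists. Deleted nodes send and list nothing. $K_3$ is the triangle. $\mathsf{BatchedList}(H)$ is the problem, in this model, that in each round every subgraph of the current graph isomorphic to $H$ is listed (IDs of its nodes output) by at least one of its nodes, and every listed set is such a subgraph. The deterministic $1$-round bandwidth complexity is the minimum $B$ for which a deterministic algorithm has correct output at every node after one round of communication following each batch. *)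

theory Defs
  imports Complex_Main "HOL-Library.Landau_Symbols"
begin

section \<open>Graphs and subgraph copies\<close>

text \<open>Nodes are identified with their (unique) IDs, which are natural numbers.\<close>

record graph =
  verts :: "nat set"
  edges :: "nat set set"

definition simple_graph :: "graph \<Rightarrow> bool" where
  "simple_graph G \<longleftrightarrow> finite (verts G) \<and> (\<forall>e\<in>edges G. e \<subseteq> verts G \<and> card e = 2)"

definition nbrs :: "graph \<Rightarrow> nat \<Rightarrow> nat set" where
  "nbrs G v = {u. {u, v} \<in> edges G}"

definition subgraph :: "graph \<Rightarrow> graph \<Rightarrow> bool" where
  "subgraph H G \<longleftrightarrow> simple_graph H \<and> verts H \<subseteq> verts G \<and> edges H \<subseteq> edges G"

definition isomorphic :: "graph \<Rightarrow> graph \<Rightarrow> bool" where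
  "isomorphic H H' \<longleftrightarrow>
     (\<exists>f. bij_betw f (verts H) (verts H') \<and> edges H' = (\<lambda>e. f ` e) ` edges H)"

definition copies :: "graph \<Rightarrow> graph \<Rightarrow> nat set set" where
  "copies H G = {verts H' | H'. subgraph H' G \<and> isomorphic H H'}"

definition complete_graph :: "nat \<Rightarrow> graph" where
  "complete_graph k = \<lparr>verts = {..<k}, edges = {e. e \<subseteq> {..<k} \<and> card e = 2}\<rparr>"


section \<open>Batched dynamic networks\<close>

text \<open>A batch is given by its net effect, the passage from \<open>G\<close> to \<open>G'\<close>. Inserting or deleting a
  node inserts or deletes its incident edges, so the updates that a node of \<open>G'\<close> is incident to are
  counted by its changed edges; a node's own insertion would only add one to this number.\<close>

definition incident_updates :: "graph \<Rightarrow> graph \<Rightarrow> nat \<Rightarrow> nat set set" where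
  "incident_updates G G' v = {e \<in> (edges G - edges G') \<union> (edges G' - edges G). v \<in> e}"

text \<open>\<open>G 0, \<dots>, G r\<close> is a batched dynamic network with at most \<open>\<Delta>\<close> updates per node and batch.
  At all times the IDs of the present nodes have at most \<open>L n\<close> bits, where \<open>n\<close> is the current
  number of nodes.\<close>

definition batched_network :: "nat \<Rightarrow> (nat \<Rightarrow> nat) \<Rightarrow> nat \<Rightarrow> (nat \<Rightarrow> graph) \<Rightarrow> bool" where
  "batched_network \<Delta> L r G \<longleftrightarrow>
     (\<forall>i\<le>r. simple_graph (G i) \<and> (\<forall>v\<in>verts (G i). v < 2 ^ L (card (verts (G i))))) \<and>
     (\<forall>i<r. \<forall>v\<in>verts (G (Suc i)). card (incident_updates (G i) (G (Suc i)) v) \<le> \<Delta>)"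


section \<open>Deterministic algorithms\<close>

text \<open>The state of a node is everything it has observed so far: its ID, the initial graph (only if
  it is a node of that graph), and, for each completed round since its insertion (latest round
  first), the messages received. The domain of such a map is the neighbor list in that
  round. As local computation is unrestricted, any deterministic state machine is a function of
  this view.\<close>

record view =
  ident :: nat
  init :: "graph option"
  past :: "(nat \<rightharpoonup> bool list) list"

text \<open>\<open>msg A w N u\<close> is the message to the neighbor \<open>u\<close> sent by a node whose view before the round is
  \<open>w\<close> and whose current neighbor list is \<open>N\<close>; \<open>out A w\<close> is the output of a node whose view after
  the round is \<open>w\<close>.\<close>

record algorithm =
  msg :: "view \<Rightarrow> nat set \<Rightarrow> nat \<Rightarrow> bool list"
  out :: "view \<Rightarrow> nat set set"

text \<open>View with which node \<open>v\<close> of \<open>G'\<close> enters the round whose batch turns \<open>G\<close> into \<open>G'\<close>: nodes of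
  \<open>G\<close> keep their view \<open>w v\<close>, whereas inserted nodes (also those present at some earlier time) know
  only their ID.\<close>

definition enter :: "graph \<Rightarrow> (nat \<Rightarrow> view) \<Rightarrow> nat \<Rightarrow> view" where
  "enter G w v = (if v \<in> verts G then w v else \<lparr>ident = v, init = None, past = []\<rparr>)"

text \<open>\<open>sent A G G' w v u\<close> is the message from \<open>v\<close> to \<open>u\<close> in that round.\<close>

definition sent ::
  "algorithm \<Rightarrow> graph \<Rightarrow> graph \<Rightarrow> (nat \<Rightarrow> view) \<Rightarrow> nat \<Rightarrow> nat \<Rightarrow> bool list" where
  "sent A G G' w v u = msg A (enter G w v) (nbrs G' v) u"

text \<open>\<open>views A G i v\<close> is the view of node \<open>v\<close> after round \<open>i\<close>. It is meaningful only for nodes \<open>v\<close>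
  of \<open>G i\<close>.\<close>

primrec views :: "algorithm \<Rightarrow> (nat \<Rightarrow> graph) \<Rightarrow> nat \<Rightarrow> nat \<Rightarrow> view" where
  "views A G 0 = (\<lambda>v. \<lparr>ident = v, init = Some (G 0), past = []\<rparr>)"
| "views A G (Suc i) = (\<lambda>v.
     let w = enter (G i) (views A G i) v;
         received = (\<lambda>u. if u \<in> nbrs (G (Suc i)) v
                         then Some (sent A (G i) (G (Suc i)) (views A G i) u v) else None)
     in w\<lparr>past := received # past w\<rparr>)"


section \<open>The listing problem and its bandwidth\<close>

definition correct_output :: "graph \<Rightarrow> graph \<Rightarrow> (nat \<Rightarrow> nat set set) \<Rightarrow> bool" where
  "correct_output H G listed \<longleftrightarrow>
     (\<forall>S\<in>copies H G. \<exists>v\<in>S. S \<in> listed v) \<and>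
     (\<forall>v\<in>verts G. listed v \<subseteq> copies H G)"

definition batched_list ::
  "graph \<Rightarrow> nat \<Rightarrow> (nat \<Rightarrow> nat) \<Rightarrow> algorithm \<Rightarrow> bool" where
  "batched_list H \<Delta> L A \<longleftrightarrow>
     (\<forall>r G. batched_network \<Delta> L r G \<longrightarrow>
        (\<forall>i<r. correct_output H (G (Suc i)) (\<lambda>v. out A (views A G (Suc i) v))))"

text \<open>The bandwidth is a function of the current number of nodes.\<close>

definition uses_bandwidth ::
  "(nat \<Rightarrow> nat) \<Rightarrow> nat \<Rightarrow> (nat \<Rightarrow> nat) \<Rightarrow> algorithm \<Rightarrow> bool" where
  "uses_bandwidth B \<Delta> L A \<longleftrightarrow>
     (\<forall>r G. batched_network \<Delta> L r G \<longrightarrow>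
        (\<forall>i<r. \<forall>v\<in>verts (G (Suc i)). \<forall>u\<in>nbrs (G (Suc i)) v.
           length (sent A (G i) (G (Suc i)) (views A G i) v u) \<le> B (card (verts (G (Suc i))))))"

end

theory Submission
  imports Defs "HOL-Library.Countable_Set" "HOL-Library.Log_Nat"
begin

text \<open>In each round \<open>u\<close> announces its lost and its new neighbors to all its current neighbors. A
  neighbor \<open>x\<close> of \<open>u\<close> then knows all edges \<open>{u, w}\<close> that are at least as recent as \<open>{u, x}\<close>. Of
  two edges \<open>{u, x}\<close>, \<open>{u, w}\<close> one is at least as recent as the other, so in a triangle
  \<open>{u, x, w}\<close> one of \<open>x\<close> and \<open>w\<close> knows all three edges.

  The subtle point is the bandwidth: a lost neighbor may have left the network, and the network may
  have shrunk so much that the ID of that neighbor is too long. Instead of the ID, \<open>u\<close> sends the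
  index of the lost neighbor in the set of neighbors of \<open>u\<close> already known to \<open>x\<close>, which \<open>u\<close> can
  compute as well. As \<open>u\<close> loses at most \<open>\<Delta>\<close> neighbors, this set has at most \<open>n + \<Delta>\<close> elements.\<close>

section \<open>Encoding finite sets of numbers\<close>

text \<open>A prefix-free code: \<open>True\<close> precedes every binary digit and
  \<open>False\<close> ends the number, so codes can be concatenated without separators.\<close>

fun nat_code :: "nat \<Rightarrow> bool list" where
  "nat_code n = (if n = 0 then [False] else True # odd n # nat_code (n div 2))"

declare nat_code.simps [simp del]

lemma nat_code_append_eq: "nat_code m @ xs = nat_code n @ ys \<longleftrightarrow> m = n \<and> xs = ys"
proof (induction m arbitrary: n rule: nat_code.induct)
  case (1 m)
  show ?case
  proof (cases "m = 0 \<or> n = 0")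
    case True
    then show ?thesis
      by (auto simp: nat_code.simps[of m] nat_code.simps[of n])
  next
    case False
    moreover have "odd m = odd n \<and> m div 2 = n div 2 \<longleftrightarrow> m = n"
      by presburger
    ultimately show ?thesis
      using "1.IH"[of "n div 2"] by (auto simp: nat_code.simps[of m] nat_code.simps[of n])
  qed
qed

lemma nat_code_not_Nil [simp]: "nat_code n \<noteq> []"
  by (subst nat_code.simps) simp

lemma length_nat_code_le: "n < 2 ^ b \<Longrightarrow> length (nat_code n) \<le> 2 * b + 1"
proof (induction b arbitrary: n)
  case (Suc b)
  have "length (nat_code (n div 2)) \<le> 2 * b + 1"
    using Suc.prems by (intro Suc.IH) auto
  then show ?case
    by (subst nat_code.simps) simp
qed (simp add: nat_code.simps)

lemma concat_nat_code_inject: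
  "concat (map nat_code ms) = concat (map nat_code ns) \<Longrightarrow> ms = ns"
proof (induction ms arbitrary: ns)
  case Nil
  then show ?case by (cases ns) auto
next
  case (Cons m ms)
  then show ?case by (cases ns) (auto simp: nat_code_append_eq)
qed

text \<open>Infinite sets all get the empty code, hence injectivity is claimed for finite sets
  only.\<close>

definition set_code :: "nat set \<Rightarrow> bool list" where
  "set_code S = concat (map nat_code (sorted_list_of_set S))"

lemma inj_on_set_code: "inj_on set_code (Collect finite)"
  by (rule inj_onI) (metis concat_nat_code_inject mem_Collect_eq set_code_def
      sorted_list_of_set(1))

lemma length_set_code_le:
  assumes "finite S" "S \<subseteq> {..<2 ^ b}"
  shows "length (set_code S) \<le> card S * (2 * b + 1)"
proof -
  have "length (set_code S) = (\<Sum>n\<leftarrow>sorted_list_of_set S. length (nat_code n))"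
    by (simp add: set_code_def length_concat comp_def)
  also have "\<dots> \<le> (\<Sum>n\<leftarrow>sorted_list_of_set S. 2 * b + 1)"
    using assms by (intro sum_list_mono length_nat_code_le) auto
  finally show ?thesis
    by (simp add: sum_list_triv)
qed

section \<open>Messages\<close>

text \<open>\<open>K\<close> is the set known to both sides; a neighborhood changes from \<open>N\<close> to \<open>N'\<close>. Even numbers
  stand for indices of lost elements of \<open>K\<close>, odd numbers for IDs of new neighbors.\<close>

definition encode :: "nat set \<Rightarrow> nat set \<Rightarrow> nat set \<Rightarrow> bool list" where
  "encode K N N' =
     set_code ((\<lambda>k. 2 * to_nat_on K k) ` (K - N') \<union> (\<lambda>a. 2 * a + 1) ` (N' - N))"

definition decode :: "nat set \<Rightarrow> bool list \<Rightarrow> nat set" where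
  "decode K m =
     (let S = inv_into (Collect finite) set_code m
      in {k \<in> K. 2 * to_nat_on K k \<notin> S} \<union> {a. 2 * a + 1 \<in> S})"

text \<open>Parity separates lost from new neighbors, and \<open>to_nat_on K\<close> is injective on
  \<open>K\<close>. Old neighbors outside \<open>K\<close> are never mentioned, so the result is
  exactly the update rule of \<open>known\<close>.\<close>

lemma decode_encode:
  assumes "finite K" "finite N'"
  shows "decode K (encode K N N') = K \<inter> N' \<union> (N' - N)"
proof -
  let ?S = "(\<lambda>k. 2 * to_nat_on K k) ` (K - N') \<union> (\<lambda>a. 2 * a + 1) ` (N' - N)"
  have "inv_into (Collect finite) set_code (encode K N N') = ?S"
    unfolding encode_def using assms by (intro inv_into_f_f inj_on_set_code) auto
  moreover have "2 * to_nat_on K k \<in> ?S \<longleftrightarrow> k \<notin> N'" if "k \<in> K" for k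
  proof -
    have "2 * to_nat_on K k \<noteq> 2 * a + 1" for a :: nat
      by presburger
    then show ?thesis
      using that assms by (auto simp: countable_finite)
  qed
  moreover have "2 * a + 1 \<in> ?S \<longleftrightarrow> a \<in> N' - N" for a
  proof -
    have "2 * a + 1 \<noteq> 2 * c" for c :: nat
      by presburger
    then show ?thesis
      by auto
  qed
  ultimately show ?thesis
    by (auto simp: decode_def Let_def)
qed

lemma length_encode_le:
  assumes "finite N" "finite N'" "K \<subseteq> N"
    and "card N \<le> 2 ^ b" "N' \<subseteq> {..<2 ^ b}"
    and "card ((N - N') \<union> (N' - N)) \<le> \<Delta>"
  shows "length (encode K N N') \<le> \<Delta> * (2 * b + 3)"
proof -
  let ?D = "(\<lambda>k. 2 * to_nat_on K k) ` (K - N')" and ?A = "(\<lambda>a. 2 * a + 1) ` (N' - N)"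
  have K: "finite K" "card K \<le> 2 ^ b"
    using assms finite_subset card_mono order_trans by metis+
  \<comment> \<open>\<open>to_nat_on\<close> numbers a finite \<open>K\<close> by
    \<open>{..<card K}\<close>, so the indices stay small however large the IDs in \<open>K\<close>
    are.\<close>
  have "to_nat_on K k < 2 ^ b" if "k \<in> K" for k
    using bij_betwE[OF to_nat_on_finite[OF K(1)]] that K(2) by fastforce
  then have D: "?D \<subseteq> {..<2 ^ Suc b}"
    by auto
  have A: "?A \<subseteq> {..<2 ^ Suc b}"
  proof (clarsimp)
    fix a assume "a \<in> N'"
    then have "a < 2 ^ b" using assms(5) by auto
    then show "Suc (2 * a) < 2 * 2 ^ b" by linarith
  qed
  have "card (?D \<union> ?A) \<le> card (K - N') + card (N' - N)"
    using K assms by (intro order_trans[OF card_Un_le] add_mono card_image_le) auto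
  also have "\<dots> \<le> card (N - N') + card (N' - N)"
    using assms by (intro add_right_mono card_mono) auto
  also have "\<dots> = card ((N - N') \<union> (N' - N))"
    using assms by (intro card_Un_disjoint[symmetric]) auto
  also have "\<dots> \<le> \<Delta>"
    by fact
  finally have "card (?D \<union> ?A) \<le> \<Delta>" .
  \<comment> \<open>\<open>Suc b\<close> in place of \<open>b\<close>: the parity tag costs one more
    bit.\<close>
  have eq: "2 * Suc b + 1 = 2 * b + 3"
    by simp
  have "length (encode K N N') \<le> card (?D \<union> ?A) * (2 * Suc b + 1)"
    unfolding encode_def using K assms D A by (intro length_set_code_le) auto
  also have "\<dots> \<le> \<Delta> * (2 * Suc b + 1)"
    using \<open>card (?D \<union> ?A) \<le> \<Delta>\<close> by (rule mult_le_mono1)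
  finally show ?thesis
    unfolding eq .
qed

section \<open>The algorithm\<close>

text \<open>The default \<open>{}\<close> is right for a node just inserted: it had no neighbors
  before the batch.\<close>

primrec last_nbrs :: "nat \<Rightarrow> graph option \<Rightarrow> (nat \<rightharpoonup> bool list) list \<Rightarrow> nat set" where
  "last_nbrs v I [] = (case I of None \<Rightarrow> {} | Some G \<Rightarrow> nbrs G v)"
| "last_nbrs v I (m # ms) = dom m"

text \<open>What \<open>v\<close> has announced to \<open>x\<close>, and what \<open>v\<close> has learned from \<open>u\<close>; both are empty for nodes
  that are not neighbors of \<open>v\<close>.\<close>

primrec announced ::
  "nat \<Rightarrow> graph option \<Rightarrow> (nat \<rightharpoonup> bool list) list \<Rightarrow> nat \<Rightarrow> nat set" where
  "announced v I [] x = (if x \<in> last_nbrs v I [] then last_nbrs v I [] else {})"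
| "announced v I (m # ms) x =
     (if x \<in> dom m then announced v I ms x \<inter> dom m \<union> (dom m - last_nbrs v I ms) else {})"

primrec learned ::
  "nat \<Rightarrow> graph option \<Rightarrow> (nat \<rightharpoonup> bool list) list \<Rightarrow> nat \<Rightarrow> nat set" where
  "learned v I [] u =
     (case I of None \<Rightarrow> {} | Some G \<Rightarrow> if u \<in> nbrs G v then nbrs G u else {})"
| "learned v I (m # ms) u =
     (case m u of None \<Rightarrow> {} | Some b \<Rightarrow> decode (learned v I ms u) b)"

text \<open>Two edges of a listed triangle come from the node's own neighbor list, the third from
  what \<open>u\<close> has announced.\<close>

definition triangle_algorithm :: algorithm where
  "triangle_algorithm =
     \<lparr>msg = (\<lambda>w N u. encode (announced (ident w) (init w) (past w) u)
                        (last_nbrs (ident w) (init w) (past w)) N),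
      out = (\<lambda>w. {{ident w, u, x} | u x.
                    {u, x} \<subseteq> last_nbrs (ident w) (init w) (past w) \<and>
                    x \<in> learned (ident w) (init w) (past w) u})\<rparr>"

text \<open>The global counterpart of \<open>announced\<close> and \<open>learned\<close>: the neighbors of \<open>u\<close> in \<open>G i\<close> that
  are known to \<open>x\<close>.\<close>

primrec known :: "(nat \<Rightarrow> graph) \<Rightarrow> nat \<Rightarrow> nat \<Rightarrow> nat \<Rightarrow> nat set" where
  "known G 0 u x = (if x \<in> nbrs (G 0) u then nbrs (G 0) u else {})"
| "known G (Suc i) u x =
     (if x \<in> nbrs (G (Suc i)) u
      then known G i u x \<inter> nbrs (G (Suc i)) u \<union> (nbrs (G (Suc i)) u - nbrs (G i) u) else {})"

text \<open>Knowledge is never outdated, since each round intersects it with the current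
  neighborhood. This makes the output sound.\<close>

lemma known_subset: "known G i u x \<subseteq> nbrs (G i) u"
  by (cases i) auto

lemma known_eq_empty: "x \<notin> nbrs (G i) u \<Longrightarrow> known G i u x = {}"
  by (cases i) auto

text \<open>If one of \<open>x\<close> and \<open>w\<close> is a new neighbor of \<open>u\<close>,
  the other hears of it now. Otherwise both were neighbors before, and the knowledge given by the
  induction hypothesis survives the intersection.\<close>

lemma known_total:
  "x \<in> nbrs (G i) u \<Longrightarrow> w \<in> nbrs (G i) u \<Longrightarrow> w \<in> known G i u x \<or> x \<in> known G i u w"
  by (induction i) auto

lemma nbrs_sym: "u \<in> nbrs G v \<longleftrightarrow> v \<in> nbrs G u"
  by (simp add: nbrs_def insert_commute)

lemma nbrs_subset_verts: "simple_graph G \<Longrightarrow> nbrs G v \<subseteq> verts G"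
  by (auto simp: simple_graph_def nbrs_def)

lemma finite_nbrs: "simple_graph G \<Longrightarrow> finite (nbrs G v)"
  using nbrs_subset_verts by (auto simp: simple_graph_def intro: finite_subset)

lemma nbrs_eq_empty: "simple_graph G \<Longrightarrow> v \<notin> verts G \<Longrightarrow> nbrs G v = {}"
  by (auto simp: simple_graph_def nbrs_def)

section \<open>Local views compared with the global knowledge\<close>

abbreviation view_nbrs :: "view \<Rightarrow> nat set" where
  "view_nbrs w \<equiv> last_nbrs (ident w) (init w) (past w)"

abbreviation view_announced :: "view \<Rightarrow> nat \<Rightarrow> nat set" where
  "view_announced w \<equiv> announced (ident w) (init w) (past w)"

abbreviation view_learned :: "view \<Rightarrow> nat \<Rightarrow> nat set" where
  "view_learned w \<equiv> learned (ident w) (init w) (past w)"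

lemma ident_views [simp]: "ident (views A G i v) = v"
  by (induction i) (auto simp: Let_def enter_def)

lemma ident_enter [simp]: "ident (enter H (views A G i) v) = v"
  by (simp add: enter_def)

lemma dom_received: "dom (\<lambda>u. if u \<in> N then Some (f u) else None) = N"
  by (auto split: if_splits)

lemma view_nbrs_views: "view_nbrs (views A G i v) = nbrs (G i) v"
  by (cases i) (simp_all add: Let_def dom_received)

lemma view_nbrs_enter:
  "simple_graph (G i) \<Longrightarrow> view_nbrs (enter (G i) (views A G i) v) = nbrs (G i) v"
  using view_nbrs_views[of A G i v] by (simp add: enter_def nbrs_eq_empty)

text \<open>Resetting the view of an inserted node does no harm: it was isolated in
  \<open>G i\<close>, so \<open>known\<close> is empty as well. The two claims concern the sender
  and the receiver.\<close>

lemma enter_known_if_views_known: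
  assumes "simple_graph (G i)"
  shows "view_announced (views A G i u) x = known G i u x \<Longrightarrow>
           view_announced (enter (G i) (views A G i) u) x = known G i u x"
    and "view_learned (views A G i x) u = known G i u x \<Longrightarrow>
           view_learned (enter (G i) (views A G i) x) u = known G i u x"
  using known_eq_empty[of x G i u] nbrs_eq_empty[OF assms] nbrs_sym[of x "G i" u]
  by (auto simp: enter_def)

text \<open>\<open>announced\<close> reads only the domains of the received maps, never the
  messages, so this holds for every algorithm \<open>A\<close>.\<close>

lemma view_announced_views:
  "(\<And>j. j < i \<Longrightarrow> simple_graph (G j)) \<Longrightarrow> view_announced (views A G i u) x = known G i u x"
proof (induction i)
  case (Suc i)
  have "view_announced (enter (G i) (views A G i) u) x = known G i u x"
    using Suc by (intro enter_known_if_views_known) auto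
  then show ?case
    using view_nbrs_enter[of G i A u] Suc.prems by (simp add: Let_def dom_received)
qed simp

lemma view_announced_enter:
  assumes "\<And>j. j \<le> i \<Longrightarrow> simple_graph (G j)"
  shows "view_announced (enter (G i) (views A G i) u) x = known G i u x"
  using assms by (intro enter_known_if_views_known view_announced_views) auto

lemma sent_triangle_algorithm:
  assumes "\<And>j. j \<le> i \<Longrightarrow> simple_graph (G j)"
  shows "sent triangle_algorithm (G i) (G (Suc i)) (views triangle_algorithm G i) u x =
           encode (known G i u x) (nbrs (G i) u) (nbrs (G (Suc i)) u)"
proof -
  let ?w = "enter (G i) (views triangle_algorithm G i) u"
  have "msg triangle_algorithm ?w N x = encode (view_announced ?w x) (view_nbrs ?w) N" for N
    by (simp add: triangle_algorithm_def)
  moreover have "view_announced ?w x = known G i u x"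
    using assms by (rule view_announced_enter)
  moreover have "view_nbrs ?w = nbrs (G i) u"
    using assms by (intro view_nbrs_enter) simp
  ultimately show ?thesis
    by (simp only: sent_def)
qed

text \<open>By induction the receiver decodes with the same set \<open>known G i u x\<close> that
  the sender used for encoding.\<close>

lemma view_learned_views:
  "(\<And>j. j \<le> i \<Longrightarrow> simple_graph (G j)) \<Longrightarrow>
     view_learned (views triangle_algorithm G i x) u = known G i u x"
proof (induction i)
  case 0
  then show ?case
    using nbrs_sym[of x "G 0" u] by simp
next
  case (Suc i)
  have learned: "view_learned (enter (G i) (views triangle_algorithm G i) x) u = known G i u x"
    using Suc by (intro enter_known_if_views_known) auto
  have "finite (known G i u x)" "finite (nbrs (G (Suc i)) u)"
    using Suc.prems by (simp_all add: finite_nbrs finite_subset[OF known_subset])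
  then show ?case
    using learned Suc.prems nbrs_sym[of x "G (Suc i)" u]
    by (simp add: Let_def sent_triangle_algorithm decode_encode)
qed

section \<open>Correctness and bandwidth\<close>

lemma complete_graph_3:
  "complete_graph 3 = \<lparr>verts = {0, 1, 2}, edges = {{0, 1}, {0, 2}, {1, 2}}\<rparr>"
proof -
  have "{..<3} = {0, 1, 2 :: nat}"
    by auto
  moreover have "e \<in> Pow {0, 1, 2} \<and> card e = 2 \<longleftrightarrow> e \<in> {{0, 1}, {0, 2}, {1, 2}}" for e :: "nat set"
    unfolding Pow_insert Pow_empty by auto
  ultimately show ?thesis
    by (auto simp: complete_graph_def)
qed

text \<open>Distinctness of \<open>a\<close>, \<open>b\<close>, \<open>c\<close> is implied, as
  edges of a simple graph have two elements.\<close>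

lemma copies_complete_graph_3:
  assumes "simple_graph G"
  shows "S \<in> copies (complete_graph 3) G \<longleftrightarrow>
           (\<exists>a b c. S = {a, b, c} \<and> {a, b} \<in> edges G \<and> {a, c} \<in> edges G \<and> {b, c} \<in> edges G)"
proof
  assume "S \<in> copies (complete_graph 3) G"
  then obtain H where H: "S = verts H" "edges H \<subseteq> edges G" "isomorphic (complete_graph 3) H"
    unfolding copies_def subgraph_def by blast
  from H(3) obtain f :: "nat \<Rightarrow> nat" where f: "bij_betw f {0, 1, 2} (verts H)"
    "edges H = (\<lambda>e. f ` e) ` {{0, 1}, {0, 2}, {1, 2}}"
    unfolding isomorphic_def complete_graph_3 graph.select_convs by blast
  have "S = {f 0, f 1, f 2}"
    using f(1) H(1) by (auto simp: bij_betw_def)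
  moreover have "{f 0, f 1} \<in> edges G" "{f 0, f 2} \<in> edges G" "{f 1, f 2} \<in> edges G"
    using H(2) f(2) by auto
  ultimately show "\<exists>a b c. S = {a, b, c} \<and> {a, b} \<in> edges G \<and> {a, c} \<in> edges G \<and> {b, c} \<in> edges G"
    by blast
next
  assume "\<exists>a b c. S = {a, b, c} \<and> {a, b} \<in> edges G \<and> {a, c} \<in> edges G \<and> {b, c} \<in> edges G"
  then obtain a b c where S: "S = {a, b, c}"
    and E: "{a, b} \<in> edges G" "{a, c} \<in> edges G" "{b, c} \<in> edges G"
    by blast
  have "card {a, b} = 2" "card {a, c} = 2" "card {b, c} = 2"
    using assms E by (auto simp: simple_graph_def)
  then have neq: "a \<noteq> b" "a \<noteq> c" "b \<noteq> c"
    by auto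
  let ?H = "\<lparr>verts = {a, b, c}, edges = {{a, b}, {a, c}, {b, c}}\<rparr>"
  let ?f = "\<lambda>i. if i = (0 :: nat) then a else if i = 1 then b else c"
  have "subgraph ?H G"
    using assms E neq unfolding subgraph_def simple_graph_def by simp blast
  moreover have "isomorphic (complete_graph 3) ?H"
    unfolding isomorphic_def complete_graph_3
    using neq by (intro exI[of _ ?f]) (auto simp: bij_betw_def inj_on_def)
  ultimately show "S \<in> copies (complete_graph 3) G"
    unfolding copies_def S mem_Collect_eq by (intro exI[of _ ?H]) simp
qed

lemma out_triangle_algorithm:
  assumes "\<And>j. j \<le> i \<Longrightarrow> simple_graph (G j)"
  shows "out triangle_algorithm (views triangle_algorithm G i v) =
           {{v, u, x} | u x. {u, x} \<subseteq> nbrs (G i) v \<and> x \<in> known G i u v}"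
proof -
  let ?w = "views triangle_algorithm G i v"
  have "out triangle_algorithm ?w =
          {{ident ?w, u, x} | u x. {u, x} \<subseteq> view_nbrs ?w \<and> x \<in> view_learned ?w u}"
    by (simp add: triangle_algorithm_def)
  moreover have "view_learned ?w = (\<lambda>u. known G i u v)"
    using assms by (intro ext view_learned_views)
  ultimately show ?thesis
    by (simp only: ident_views view_nbrs_views[unfolded ident_views])
qed

lemma batched_list_triangle_algorithm:
  "batched_list (complete_graph 3) \<Delta> L triangle_algorithm"
  unfolding batched_list_def
proof (intro allI impI)
  fix r G i
  assume "batched_network \<Delta> L r G" "i < r"
  then have simple: "\<And>j. j \<le> Suc i \<Longrightarrow> simple_graph (G j)"
    by (simp add: batched_network_def)
  let ?G = "G (Suc i)"
  let ?out = "\<lambda>v. out triangle_algorithm (views triangle_algorithm G (Suc i) v)"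
  have out: "?out v = {{v, u, x} | u x. {u, x} \<subseteq> nbrs ?G v \<and> x \<in> known G (Suc i) u v}" for v
    using simple by (rule out_triangle_algorithm)
  note copies = copies_complete_graph_3[OF simple[OF order_refl]]
  show "correct_output (complete_graph 3) ?G ?out"
    unfolding correct_output_def
  proof (intro conjI ballI subsetI)
    fix S assume "S \<in> copies (complete_graph 3) ?G"
    then obtain u x w where S: "S = {u, x, w}"
      and E: "{u, x} \<in> edges ?G" "{u, w} \<in> edges ?G" "{x, w} \<in> edges ?G"
      unfolding copies by blast
    then have N: "{u, w} \<subseteq> nbrs ?G x" "{u, x} \<subseteq> nbrs ?G w" "{x, w} \<subseteq> nbrs ?G u"
      by (auto simp: nbrs_def insert_commute)
    \<comment> \<open>Any vertex of the triangle could take the role of the announcing node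
      \<open>u\<close>.\<close>
    then consider "w \<in> known G (Suc i) u x" | "x \<in> known G (Suc i) u w"
      using known_total[of x G "Suc i" u w] by blast
    then show "\<exists>v\<in>S. S \<in> ?out v"
    proof cases
      case 1
      then have "{x, u, w} \<in> ?out x"
        unfolding out using N by blast
      then show ?thesis
        using S by (auto simp: insert_commute)
    next
      case 2
      then have "{w, u, x} \<in> ?out w"
        unfolding out using N by blast
      then show ?thesis
        using S by (auto simp: insert_commute)
    qed
  next
    fix v S assume "S \<in> ?out v"
    then obtain u x where S: "S = {v, u, x}" and N: "{u, x} \<subseteq> nbrs ?G v"
      and "x \<in> known G (Suc i) u v"
      unfolding out by blast
    then have "x \<in> nbrs ?G u"
      by (meson known_subset subsetD)
    then have "{v, u} \<in> edges ?G" "{v, x} \<in> edges ?G" "{u, x} \<in> edges ?G"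
      using N by (simp_all add: nbrs_def insert_commute)
    then show "S \<in> copies (complete_graph 3) ?G"
      unfolding copies S by blast
  qed
qed

section \<open>Bandwidth\<close>

lemma card_nbrs_changes_le:
  assumes "simple_graph G" "simple_graph G'"
  shows "card ((nbrs G v - nbrs G' v) \<union> (nbrs G' v - nbrs G v)) \<le> card (incident_updates G G' v)"
proof (rule card_inj_on_le)
  show "inj_on (\<lambda>u. {u, v}) ((nbrs G v - nbrs G' v) \<union> (nbrs G' v - nbrs G v))"
    by (auto simp: inj_on_def doubleton_eq_iff)
  show "(\<lambda>u. {u, v}) ` ((nbrs G v - nbrs G' v) \<union> (nbrs G' v - nbrs G v))
          \<subseteq> incident_updates G G' v"
    by (auto simp: nbrs_def incident_updates_def)
  have "incident_updates G G' v \<subseteq> Pow (verts G \<union> verts G')"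
    using assms unfolding incident_updates_def simple_graph_def by blast
  then show "finite (incident_updates G G' v)"
    using assms by (elim finite_subset) (simp add: simple_graph_def)
qed

text \<open>One exponent for both kinds of numbers sent: \<open>L n\<close> bounds the IDs of new
  neighbors, \<open>floorlog 2 n + \<Delta>\<close> the indices of lost ones.\<close>

definition id_bits :: "nat \<Rightarrow> (nat \<Rightarrow> nat) \<Rightarrow> nat \<Rightarrow> nat" where
  "id_bits \<Delta> L n = L n + floorlog 2 n + \<Delta>"

lemma add_le_two_power_id_bits: "n + \<Delta> \<le> 2 ^ id_bits \<Delta> L n"
proof -
  have "n < 2 ^ floorlog 2 n"
    using floorlog_bounds[of n 2] by (cases "n = 0") (auto simp: floorlog_def)
  \<comment> \<open>The product on the left exceeds \<open>n + \<Delta>\<close>, and its factors are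
    bounded separately.\<close>
  then have "(n + 1) * (\<Delta> + 1) \<le> 2 ^ floorlog 2 n * 2 ^ \<Delta>"
    using less_exp[of \<Delta>] by (intro mult_mono) (simp_all only: Suc_eq_plus1[symmetric] Suc_leI zero_le)
  also have "\<dots> \<le> 2 ^ id_bits \<Delta> L n"
    unfolding id_bits_def power_add[symmetric] by (intro power_increasing) auto
  finally show ?thesis
    by (simp add: algebra_simps)
qed

lemma uses_bandwidth_triangle_algorithm:
  "uses_bandwidth (\<lambda>n. \<Delta> * (2 * id_bits \<Delta> L n + 3)) \<Delta> L triangle_algorithm"
  unfolding uses_bandwidth_def
proof (intro allI impI ballI)
  fix r G i v u
  assume network: "batched_network \<Delta> L r G" "i < r" and v: "v \<in> verts (G (Suc i))"
  then have simple: "\<And>j. j \<le> Suc i \<Longrightarrow> simple_graph (G j)"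
    by (simp add: batched_network_def)
  define N N' n where "N = nbrs (G i) v" and "N' = nbrs (G (Suc i)) v"
    and "n = card (verts (G (Suc i)))"
  have fin: "finite N" "finite N'"
    using simple by (auto simp: N_def N'_def finite_nbrs)
  have "card (incident_updates (G i) (G (Suc i)) v) \<le> \<Delta>"
    using network v by (simp add: batched_network_def)
  then have changes: "card ((N - N') \<union> (N' - N)) \<le> \<Delta>"
    unfolding N_def N'_def using card_nbrs_changes_le[of "G i" "G (Suc i)" v] simple by force
  have N': "N' \<subseteq> verts (G (Suc i))"
    using simple by (simp add: N'_def nbrs_subset_verts)
  \<comment> \<open>The old neighborhood must be bounded by the new number of nodes: all but at most
    \<open>\<Delta>\<close> old neighbors are still neighbors.\<close>
  have "card N \<le> card (N' \<union> ((N - N') \<union> (N' - N)))"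
    using fin by (intro card_mono) auto
  also have "\<dots> \<le> card N' + \<Delta>"
    using changes card_Un_le[of N' "(N - N') \<union> (N' - N)"] by linarith
  also have "\<dots> \<le> n + \<Delta>"
    using N' simple[of "Suc i"] by (auto simp: n_def simple_graph_def intro: card_mono)
  also have "\<dots> \<le> 2 ^ id_bits \<Delta> L n"
    by (rule add_le_two_power_id_bits)
  finally have card_N: "card N \<le> 2 ^ id_bits \<Delta> L n" .
  have "N' \<subseteq> {..<2 ^ L n}"
    using N' network by (auto simp: batched_network_def n_def)
  also have "\<dots> \<subseteq> {..<2 ^ id_bits \<Delta> L n}"
    by (simp add: id_bits_def)
  finally have ids: "N' \<subseteq> {..<2 ^ id_bits \<Delta> L n}" .
  show "length (sent triangle_algorithm (G i) (G (Suc i)) (views triangle_algorithm G i) v u)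
          \<le> \<Delta> * (2 * id_bits \<Delta> L (card (verts (G (Suc i)))) + 3)"
    using length_encode_le[OF fin _ card_N ids changes, of "known G i v u"]
      known_subset[of G i v u] sent_triangle_algorithm[of i G v u] simple
    by (simp add: N_def N'_def n_def)
qed

lemma id_bits_bigo:
  assumes "(\<lambda>n. real (L n)) \<in> O(\<lambda>n. log 2 (real n))"
  shows "(\<lambda>n. real (\<Delta> * (2 * id_bits \<Delta> L n + 3))) \<in> O(\<lambda>n. log 2 (real n))"
proof -
  have log_ge: "eventually (\<lambda>n. 1 \<le> log 2 (real n)) sequentially"
    using eventually_ge_at_top[of 2] by eventually_elim (simp add: le_log_iff)
  have const: "(\<lambda>_. c) \<in> O(\<lambda>n. log 2 (real n))" for c :: real
    using log_ge
    by (intro landau_o.bigI[of "\<bar>c\<bar> + 1"] eventually_mono[OF log_ge])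
       (auto intro: order_trans[OF _ mult_left_mono[of 1]])
  \<comment> \<open>The factor 2 absorbs the \<open>+ 1\<close> in \<open>floorlog\<close>, because
    the logarithm is eventually at least 1.\<close>
  have "eventually (\<lambda>n. norm (real (floorlog 2 n)) \<le> 2 * norm (log 2 (real n))) sequentially"
    using log_ge eventually_gt_at_top[of 0]
  proof eventually_elim
    case (elim n)
    then have "real (floorlog 2 n) = of_int \<lfloor>log 2 (real n)\<rfloor> + 1"
      by (simp add: floorlog_def)
    then show ?case
      using elim(1) of_int_floor_le[of "log 2 (real n)"] unfolding real_norm_def by linarith
  qed
  then have floorlog: "(\<lambda>n. real (floorlog 2 n)) \<in> O(\<lambda>n. log 2 (real n))"
    by (rule bigoI)
  let ?b = "\<lambda>n. real (L n) + real (floorlog 2 n) + real \<Delta>"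
  have "?b \<in> O(\<lambda>n. log 2 (real n))"
    by (intro sum_in_bigo assms floorlog const)
  then have "(\<lambda>n. 2 * ?b n) \<in> O(\<lambda>n. log 2 (real n))"
    by (subst landau_o.big.cmult_in_iff) auto
  then have "(\<lambda>n. 2 * ?b n + 3) \<in> O(\<lambda>n. log 2 (real n))"
    by (intro sum_in_bigo const)
  then have "(\<lambda>n. real \<Delta> * (2 * ?b n + 3)) \<in> O(\<lambda>n. log 2 (real n))"
    by (cases "\<Delta> = 0") (simp_all only: landau_o.big.cmult_in_iff of_nat_eq_0_iff not_False_eq_True,
        auto)
  then show ?thesis
    by (simp add: id_bits_def)
qed

theorem theorem3:
  fixes \<Delta> :: nat and L :: "nat \<Rightarrow> nat"
  assumes "(\<lambda>n. real (L n)) \<in> O(\<lambda>n. log 2 (real n))"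
  shows "\<exists>(A :: algorithm) (B :: nat \<Rightarrow> nat).
           batched_list (complete_graph 3) \<Delta> L A \<and> uses_bandwidth B \<Delta> L A \<and>
           (\<lambda>n. real (B n)) \<in> O(\<lambda>n. log 2 (real n))"
  using batched_list_triangle_algorithm uses_bandwidth_triangle_algorithm id_bits_bigo[OF assms]
  by blast

end
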